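(* Let $a,b\ge 0$ with $(a,b)\neq(0,0)$, and consider the inverse-linear loss function $$L(x)=\begin{cases} a(1/x-1) & \text{if } 0<x\le 1,\\ b(x-1) & \text{if } x>1.\end{cases}$$ Let $r\ge 2$ be an integer and define $$\tilde\Omega=\begin{cases}(r-1)\left(1+\frac{a+b}{2b}\left(\sqrt{1+\frac{4ab}{(r-1)(a+b)^2}}-1\right)\right) & \text{for } a,b>0,\\ r-1 & \text{for } a=0,\ b>0,\\ r & \text{for } b=0,\ a>0.\end{cases}$$ For $p\in(0,1)$ let $N$ be the number of trials in inverse binomial sampling with parameters $r$ and $p$, and let $\eta(p)=\mathrm{E}[L(\hat p/p)]$ be the risk of the estimator $\hat p=\tilde\Omega/N$. Then $\lim_{p\to0}\eta(p)$ exists and equals $$\lim_{p\to 0}\eta(p)=a\left(\frac{r}{\tilde\Omega}-1\right)+\left(\frac{ar}{\tilde\Omega}+b\right)\frac{\tilde\Omega^{r-1}\exp(-\tilde\Omega)}{(r-1)!},$$ and $$\eta(p)<a\left(\frac{r}{\tilde\Omega}-1\right)+\left(\frac{ar}{\tilde\Omega}+b\right)\frac{\tilde\Omega^{r-1}\exp(-\tilde\Omega)}{(r-1)!}\quad\text{for any } p\in(0,1).$$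
   Context: Inverse binomial sampling: in a sequence of independent Bernoulli trials with success probability $p\in(0,1)$, observations are taken until exactly $r$ successes are obtained; $N$ is the (random) number of observations. Thus $N$ has the negative binomial distribution $P[N=n]=\binom{n-1}{r-1}p^r(1-p)^{n-r}$, $n\ge r$. For an estimator $\hat p=g(N)$ the risk is $\eta(p)=\mathrm{E}[L(\hat p/p)]=\sum_{n=r}^\infty P[N=n]\,L(g(n)/p)$. *)

theory Defs
  imports "HOL-Probability.Probability"
begin

definition trials :: "real \<Rightarrow> bool stream measure" where
  "trials p = stream_space (measure_pmf (bernoulli_pmf p))"

definition successes :: "nat \<Rightarrow> bool stream \<Rightarrow> nat" where
  "successes n \<omega> = card {i. i < n \<and> \<omega> !! i}"

text \<open>
  If \<open>\<omega>\<close> contains fewer than \<open>r\<close> successes, the value below is unspecified; for \<open>0 < p < 1\<close>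
  and \<open>r \<ge> 1\<close> this is a null event (see \<open>AE_first_at\<close>).
\<close>

definition num_obs :: "nat \<Rightarrow> bool stream \<Rightarrow> nat" where
  "num_obs r \<omega> = (LEAST n. successes n \<omega> = r)"

text \<open>Only arguments \<open>x > 0\<close> are meaningful.\<close>

definition inv_lin_loss :: "real \<Rightarrow> real \<Rightarrow> real \<Rightarrow> real" where
  "inv_lin_loss a b x = (if x \<le> 1 then a * (1 / x - 1) else b * (x - 1))"

definition risk :: "(real \<Rightarrow> real) \<Rightarrow> (nat \<Rightarrow> real) \<Rightarrow> nat \<Rightarrow> real \<Rightarrow> real" where
  "risk L g r p = (LINT \<omega>|trials p. L (g (num_obs r \<omega>) / p))"

definition Omega_opt :: "real \<Rightarrow> real \<Rightarrow> nat \<Rightarrow> real" where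
  "Omega_opt a b r =
     (if a = 0 then real r - 1
      else if b = 0 then real r
      else (real r - 1) *
        (1 + (a + b) / (2 * b) * (sqrt (1 + 4 * a * b / ((real r - 1) * (a + b)\<^sup>2)) - 1)))"


subsection \<open>The distribution of the number of observations\<close>

definition first_at :: "nat \<Rightarrow> nat \<Rightarrow> bool stream \<Rightarrow> bool" where
  "first_at r n \<omega> \<longleftrightarrow> successes n \<omega> = r \<and> (\<forall>m<n. successes m \<omega> \<noteq> r)"

lemma num_obs_eqI: "first_at r n \<omega> \<Longrightarrow> num_obs r \<omega> = n"
  unfolding num_obs_def first_at_def by (rule Least_equality) (auto simp: not_less[symmetric])

lemma successes_0 [simp]: "successes 0 \<omega> = 0"
  by (simp add: successes_def)

lemma successes_Suc_Stream [simp]: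
  "successes (Suc n) (x ## \<omega>) = (if x then Suc (successes n \<omega>) else successes n \<omega>)"
proof -
  have *: "{i. i < Suc n \<and> (x ## \<omega>) !! i} = (if x then {0} else {}) \<union> Suc ` {i. i < n \<and> \<omega> !! i}"
    (is "?A = ?B")
  proof (rule set_eqI)
    fix i show "i \<in> ?A \<longleftrightarrow> i \<in> ?B" by (cases i) auto
  qed
  show ?thesis unfolding successes_def *
    by (subst card_Un_disjoint) (auto simp: card_image)
qed

lemma first_at_0: "first_at 0 n \<omega> \<longleftrightarrow> n = 0"
  by (cases n) (auto simp: first_at_def)

lemma first_at_Suc_0: "\<not> first_at (Suc r) 0 \<omega>"
  by (auto simp: first_at_def)

lemma first_at_Suc_Stream:
  "first_at (Suc r) (Suc n) (x ## \<omega>) \<longleftrightarrow> (if x then first_at r n \<omega> else first_at (Suc r) n \<omega>)"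
proof -
  have "(\<forall>m<Suc n. successes m (x ## \<omega>) \<noteq> Suc r) \<longleftrightarrow> (\<forall>m<n. successes (Suc m) (x ## \<omega>) \<noteq> Suc r)"
    by (auto simp: All_less_Suc2)
  then show ?thesis by (auto simp: first_at_def)
qed

lemma sets_trials [measurable_cong]: "sets (trials p) = sets (stream_space (count_space UNIV))"
  unfolding trials_def by (rule sets_stream_space_cong) simp

lemma space_trials [simp]: "space (trials p) = UNIV"
  by (simp add: trials_def space_stream_space)

interpretation trials: prob_space "trials p" for p
  unfolding trials_def by (rule prob_space.prob_space_stream_space[OF prob_space_measure_pmf])

lemma measurable_successes [measurable]: "successes n \<in> trials p \<rightarrow>\<^sub>M count_space UNIV"
  unfolding successes_def by measurable

lemma measurable_first_at [measurable]: "Measurable.pred (trials p) (first_at r n)"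
  unfolding first_at_def by measurable

lemma measurable_num_obs [measurable]: "num_obs r \<in> trials p \<rightarrow>\<^sub>M count_space UNIV"
  unfolding num_obs_def by measurable

lemma prob_first_at_rec:
  assumes "0 < p" "p < 1"
  shows "measure (trials p) {\<omega>. first_at (Suc r) (Suc n) \<omega>} =
    p * measure (trials p) {\<omega>. first_at r n \<omega>} + (1 - p) * measure (trials p) {\<omega>. first_at (Suc r) n \<omega>}"
proof -
  have m: "{\<omega>. first_at s k \<omega>} \<in> sets (stream_space (measure_pmf (bernoulli_pmf p)))" for s k
    using measurable_first_at[where p = p and r = s and n = k] unfolding pred_def by (simp add: trials_def space_stream_space)
  have "ennreal (measure (trials p) {\<omega>. first_at (Suc r) (Suc n) \<omega>}) =
      emeasure (stream_space (measure_pmf (bernoulli_pmf p))) {\<omega>. first_at (Suc r) (Suc n) \<omega>}"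
    by (simp add: trials.emeasure_eq_measure flip: trials_def)
  also have "\<dots> = (\<integral>\<^sup>+x. emeasure (trials p) {\<omega>. x ## \<omega> \<in> {\<omega>. first_at (Suc r) (Suc n) \<omega>}}
      \<partial>bernoulli_pmf p)"
    by (subst prob_space.emeasure_stream_space[OF prob_space_measure_pmf m]) (simp add: trials_def space_stream_space)
  also have "\<dots> = ennreal p * emeasure (trials p) {\<omega>. first_at r n \<omega>} +
      ennreal (1 - p) * emeasure (trials p) {\<omega>. first_at (Suc r) n \<omega>}"
    using assms by (simp add: first_at_Suc_Stream mult.commute)
  also have "\<dots> = ennreal (p * measure (trials p) {\<omega>. first_at r n \<omega>}
      + (1 - p) * measure (trials p) {\<omega>. first_at (Suc r) n \<omega>})"
    using assms by (simp add: trials.emeasure_eq_measure ennreal_mult' ennreal_plus)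
  finally show ?thesis using assms by (subst (asm) ennreal_inj) auto
qed

lemma prob_first_at:
  assumes "0 < p" "p < 1" "r \<ge> 1"
  shows "measure (trials p) {\<omega>. first_at r n \<omega>} =
    (if r \<le> n then real ((n - 1) choose (r - 1)) * p ^ r * (1 - p) ^ (n - r) else 0)"
  using assms(3)
proof (induction n arbitrary: r)
  case 0
  then show ?case by (cases r) (auto simp: first_at_Suc_0)
next
  case (Suc n)
  then obtain s where r: "r = Suc s" by (cases r) auto
  have rec: "measure (trials p) {\<omega>. first_at r (Suc n) \<omega>} =
    p * measure (trials p) {\<omega>. first_at s n \<omega>} + (1 - p) * measure (trials p) {\<omega>. first_at (Suc s) n \<omega>}"
    unfolding r using assms by (intro prob_first_at_rec) auto
  have IH1: "measure (trials p) {\<omega>. first_at (Suc s) n \<omega>} =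
    (if Suc s \<le> n then real ((n - 1) choose s) * p ^ Suc s * (1 - p) ^ (n - Suc s) else 0)"
    using Suc.IH[of "Suc s"] by simp
  show ?case
  proof (cases s)
    case 0
    have "measure (trials p) {\<omega>. first_at s n \<omega>} = (if n = 0 then 1 else 0)"
      using trials.prob_space[of p] by (simp add: 0 first_at_0)
    then show ?thesis unfolding rec IH1
      by (cases n) (simp_all add: r 0)
  next
    case (Suc t)
    have IH0: "measure (trials p) {\<omega>. first_at s n \<omega>} =
      (if s \<le> n then real ((n - 1) choose (s - 1)) * p ^ s * (1 - p) ^ (n - s) else 0)"
      using Suc.IH[of s] Suc by simp
    show ?thesis
    proof (cases n)
      case 0
      then show ?thesis unfolding rec IH1 IH0 by (simp add: r Suc)
    next
      case n: (Suc m)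
      consider "n < s" | "n = s" | "Suc s \<le> n" by linarith
      then show ?thesis
      proof cases
        case 1
        then show ?thesis unfolding rec IH1 IH0 by (simp add: r Suc n)
      next
        case 2
        then show ?thesis unfolding rec IH1 IH0 by (simp add: r Suc n)
      next
        case 3
        then obtain d where m: "m = Suc t + d" using Suc n by (auto simp: le_iff_add)
        have "Suc (t + d) - t = Suc d" by simp
        then show ?thesis unfolding rec IH1 IH0
          by (simp add: r Suc n m ring_distribs mult_ac)
      qed
    qed
  qed
qed

lemma pmf_shifted_neg_binomial:
  assumes "0 < p" "p < 1" "r \<ge> 1"
  shows "pmf (map_pmf (\<lambda>k. k + r) (neg_binomial_pmf r p)) n =
    (if r \<le> n then real ((n - 1) choose (r - 1)) * p ^ r * (1 - p) ^ (n - r) else 0)"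
proof (cases "r \<le> n")
  case True
  then obtain k where n: "n = k + r" by (metis le_add_diff_inverse2)
  have "pmf (map_pmf (\<lambda>k. k + r) (neg_binomial_pmf r p)) n = pmf (neg_binomial_pmf r p) k"
    unfolding n by (rule pmf_map_inj') (auto simp: inj_def)
  also have "\<dots> = real ((k + r - 1) choose k) * p ^ r * (1 - p) ^ k"
    using assms by (intro pmf_neg_binomial) auto
  also have "(k + r - 1) choose k = (k + r - 1) choose (r - 1)"
    using assms binomial_symmetric[of k "k + r - 1"] by simp
  finally show ?thesis by (simp add: n)
next
  case False
  then have "(\<lambda>k. k + r) -` {n} = {}" by auto
  with False show ?thesis by (simp add: pmf_map)
qed

lemma prob_first_at_eq_pmf:
  assumes "0 < p" "p < 1" "r \<ge> 1"
  shows "measure (trials p) {\<omega>. first_at r n \<omega>} = pmf (map_pmf (\<lambda>k. k + r) (neg_binomial_pmf r p)) n"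
  using assms by (simp only: prob_first_at pmf_shifted_neg_binomial)

lemma AE_first_at:
  assumes "0 < p" "p < 1" "r \<ge> 1"
  shows "AE \<omega> in trials p. first_at r (num_obs r \<omega>) \<omega>"
proof -
  define q where "q = map_pmf (\<lambda>k. k + r) (neg_binomial_pmf r p)"
  have disj: "disjoint_family (\<lambda>n. {\<omega>. first_at r n \<omega>})"
    by (auto simp: disjoint_family_on_def dest: num_obs_eqI)
  have sets: "{\<omega>. first_at r n \<omega>} \<in> sets (trials p)" for n
    using measurable_first_at[where p = p and r = r and n = n] unfolding pred_def by simp
  have "emeasure (trials p) (\<Union>n. {\<omega>. first_at r n \<omega>}) = (\<Sum>n. emeasure (trials p) {\<omega>. first_at r n \<omega>})"
    using sets by (intro suminf_emeasure[symmetric] disj) auto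
  also have "\<dots> = (\<Sum>n. emeasure (measure_pmf q) {n})"
    using assms by (simp add: trials.emeasure_eq_measure prob_first_at_eq_pmf emeasure_pmf_single q_def)
  also have "\<dots> = emeasure (measure_pmf q) (\<Union>n. {n})"
    by (intro suminf_emeasure) (auto simp: disjoint_family_on_def)
  also have "\<dots> = 1" using measure_pmf.emeasure_space_1[of q] by simp
  finally have "measure (trials p) (\<Union>n. {\<omega>. first_at r n \<omega>}) = 1"
    by (simp add: trials.emeasure_eq_measure)
  then have "AE \<omega> in trials p. \<omega> \<in> (\<Union>n. {\<omega>. first_at r n \<omega>})"
    using sets by (subst trials.prob_eq_1[symmetric]) auto
  then show ?thesis by eventually_elim (auto dest: num_obs_eqI)
qed

lemma prob_num_obs:
  assumes "0 < p" "p < 1" "r \<ge> 1"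
  shows "measure (trials p) {\<omega>. num_obs r \<omega> = n} =
    (if r \<le> n then real ((n - 1) choose (r - 1)) * p ^ r * (1 - p) ^ (n - r) else 0)"
proof -
  have "measure (trials p) {\<omega>. num_obs r \<omega> = n} = measure (trials p) {\<omega>. first_at r n \<omega>}"
  proof (rule trials.finite_measure_eq_AE)
    show "AE \<omega> in trials p. (\<omega> \<in> {\<omega>. num_obs r \<omega> = n}) = (\<omega> \<in> {\<omega>. first_at r n \<omega>})"
      using AE_first_at[OF assms] by eventually_elim (auto dest: num_obs_eqI)
  next
    show "{\<omega>. num_obs r \<omega> = n} \<in> sets (trials p)"
      using measurable_sets[OF measurable_num_obs[where p = p and r = r], of "{n}"] by (simp add: vimage_def)
  next
    show "{\<omega>. first_at r n \<omega>} \<in> sets (trials p)"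
      using measurable_first_at[where p = p and r = r and n = n] unfolding pred_def by simp
  qed
  then show ?thesis using assms by (simp only: prob_first_at)
qed

lemma distr_num_obs:
  assumes "0 < p" "p < 1" "r \<ge> 1"
  shows "distr (trials p) (count_space UNIV) (num_obs r) =
    measure_pmf (map_pmf (\<lambda>k. k + r) (neg_binomial_pmf r p))" (is "?D = measure_pmf ?q")
proof (rule measure_eqI_countable[where A = UNIV])
  fix n :: nat
  have "emeasure ?D {n} = emeasure (trials p) {\<omega>. num_obs r \<omega> = n}"
    by (subst emeasure_distr) (auto simp: vimage_def)
  also have "\<dots> = ennreal (pmf ?q n)"
    using assms
    by (simp only: trials.emeasure_eq_measure prob_num_obs pmf_shifted_neg_binomial)
  finally show "emeasure ?D {n} = emeasure ?q {n}"
    by (simp add: emeasure_pmf_single)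
qed auto

lemma risk_eq_expectation:
  assumes "0 < p" "p < 1" "r \<ge> 1"
  shows "risk L g r p =
    measure_pmf.expectation (map_pmf (\<lambda>k. k + r) (neg_binomial_pmf r p)) (\<lambda>n. L (g n / p))"
  unfolding risk_def distr_num_obs[OF assms, symmetric]
  by (subst integral_distr) auto

text \<open>The Bochner integral of a non-integrable function is 0; this does not occur here.\<close>

lemma integrable_inv_lin_loss:
  assumes p: "0 < p" "p < 1" and r: "r \<ge> 1" and w: "w > 0"
  shows "integrable (trials p) (\<lambda>\<omega>. inv_lin_loss a b (w / real (num_obs r \<omega>) / p))"
proof -
  have "integrable (measure_pmf (neg_binomial_pmf r p)) (\<lambda>k. inv_lin_loss a b (w / real (k + r) / p))"
  proof (rule Bochner_Integration.integrable_bound)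
    show "integrable (measure_pmf (neg_binomial_pmf r p))
        (\<lambda>k. \<bar>a\<bar> * p / w * (real k + real r) + \<bar>a\<bar> + \<bar>b\<bar> * (w / p + 1))"
      using p by (intro Bochner_Integration.integrable_add integrable_mult_right
          integrable_neg_binomial_pmf_real) auto
    show "AE k in measure_pmf (neg_binomial_pmf r p).
        norm (inv_lin_loss a b (w / real (k + r) / p))
        \<le> norm (\<bar>a\<bar> * p / w * (real k + real r) + \<bar>a\<bar> + \<bar>b\<bar> * (w / p + 1))"
    proof (rule AE_I2)
      fix k
      define n where "n = real k + real r"
      have n: "n \<ge> 1" using r by (simp add: n_def)
      define A where "A = \<bar>a\<bar> * p / w * n + \<bar>a\<bar>"
      define B where "B = \<bar>b\<bar> * (w / p + 1)"
      have A: "A \<ge> 0" and B: "B \<ge> 0" using p w n by (auto simp: A_def B_def)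
      have "\<bar>a * (1 / (w / n / p) - 1)\<bar> \<le> \<bar>a\<bar> * (n * p / w + 1)"
      proof -
        have "n * p / w > 0" using p w n by simp
        then have "\<bar>n * p / w - 1\<bar> \<le> n * p / w + 1" by linarith
        then show ?thesis unfolding abs_mult by (intro mult_left_mono) (auto simp: mult.commute)
      qed
      then have 1: "\<bar>a * (1 / (w / n / p) - 1)\<bar> \<le> A" by (simp add: A_def algebra_simps)
      have "w / n / p \<le> w / p" using p w n by (simp add: field_simps)
      moreover have "w / n / p > 0" using p w n by simp
      ultimately have "\<bar>w / n / p - 1\<bar> \<le> w / p + 1" by linarith
      then have 2: "\<bar>b * (w / n / p - 1)\<bar> \<le> B"
        unfolding abs_mult B_def by (rule mult_left_mono) simp
      have "\<bar>inv_lin_loss a b (w / n / p)\<bar> \<le> A + B"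
        unfolding inv_lin_loss_def using 1 2 A B by (simp del: divide_divide_eq_left split: if_split)
      then show "norm (inv_lin_loss a b (w / real (k + r) / p))
        \<le> norm (\<bar>a\<bar> * p / w * (real k + real r) + \<bar>a\<bar> + \<bar>b\<bar> * (w / p + 1))"
        using A B by (simp add: A_def B_def n_def)
    qed
  qed simp
  then have "integrable (distr (trials p) (count_space UNIV) (num_obs r))
      (\<lambda>n. inv_lin_loss a b (w / real n / p))"
    unfolding distr_num_obs[OF p r] map_pmf_rep_eq by (subst integrable_distr_eq) auto
  then show ?thesis by (subst (asm) integrable_distr_eq) auto
qed

end

theory Submission
  imports Defs "HOL-Real_Asymp.Real_Asymp"
begin

text \<open>
  Write \<open>k = r - 1\<close>, \<open>m = \<lfloor>\<Omega> / p\<rfloor>\<close> and \<open>f(n) = P[N = n]\<close>. Since \<open>E[N] = r / p\<close>, the risk is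
  \<open>a (r / \<Omega> - 1) + \<Sum>n\<le>m. f(n) (b (\<Omega> / (n p) - 1) - a (n p / \<Omega> - 1))\<close>. The constant \<open>\<Omega>\<close> is the positive
  root of \<open>b (\<Omega> / k - 1) + a (1 - r / \<Omega>) = 0\<close>, and exactly under this condition the sum telescopes once
  \<open>\<Omega> / (n p)\<close> is enlarged to \<open>\<Omega> / ((n - 1) p)\<close>: it becomes
  \<open>V(m, p) (b \<Omega> / k + a m p / \<Omega>)\<close> with \<open>V(m, p) = (m - 1 choose k) p^k (1 - p)^(m - k)\<close>. As
  \<open>m p \<le> \<Omega>\<close>, the upper bound reduces to \<open>V(m, p) < \<Omega>^k exp(-\<Omega>) / k!\<close>. For this put \<open>u = \<Omega> / p\<close>, so
  \<open>m \<le> u < m + 1\<close>; then \<open>V(m, \<Omega> / u)\<close> strictly increases under \<open>(m, u) \<mapsto> (m + 1, u + 1)\<close>, and along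
  this sequence it tends to the Poisson value on the right. For \<open>p \<rightarrow> 0\<close> the same Poisson limit gives the
  main term, and the error of the replacement is a multiple of \<open>E[1 / (N' + 1); N' < m]\<close> for the number
  \<open>N'\<close> of trials up to the \<open>k\<close>-th success, which vanishes because \<open>N'\<close> tends to infinity in probability.
\<close>

section \<open>Logarithmic inequalities\<close>

text \<open>
  The function \<open>x \<mapsto> c ln x - (c + 1) ln (x + 1)\<close> is maximal at \<open>x = c\<close> and decreasing beyond; the
  right-hand side is nonpositive for \<open>x = c\<close> and for \<open>c \<le> x \<le> z\<close>.
\<close>

lemma mult_ln_diff_le:
  fixes c x z :: real
  assumes "c \<ge> 0" "x > 0" "z > 0"
  shows "(c * ln z - (c + 1) * ln (z + 1)) - (c * ln x - (c + 1) * ln (x + 1))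
    \<le> (z - x) / (z + 1) * (c / x - 1)"
proof -
  have "ln (z * (x + 1) / (x * (z + 1))) \<le> z * (x + 1) / (x * (z + 1)) - 1"
    using assms by (intro ln_le_minus_one) simp
  also have "\<dots> = (z - x) / (z + 1) / x"
    using assms by (simp add: divide_simps) (simp add: algebra_simps)
  finally have 1: "c * (ln z + ln (x + 1) - ln x - ln (z + 1)) \<le> c * ((z - x) / (z + 1) / x)"
    using assms by (intro mult_left_mono) (simp_all add: ln_mult ln_div)
  have "ln ((x + 1) / (z + 1)) \<le> (x + 1) / (z + 1) - 1"
    using assms by (intro ln_le_minus_one) simp
  also have "\<dots> = - ((z - x) / (z + 1))"
    using assms by (simp add: field_simps)
  finally have 2: "ln (x + 1) - ln (z + 1) \<le> - ((z - x) / (z + 1))"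
    using assms by (simp add: ln_div)
  define d where "d = (z - x) / (z + 1)"
  from 1 2 show ?thesis unfolding d_def[symmetric] by (simp add: algebra_simps)
qed

text \<open>Logarithmic form of the classical fact that \<open>(1 + 1 / l) ^ (l + 1)\<close>
  decreases in \<open>l\<close>. One step is \<open>mult_ln_diff_le\<close> at the maximum
  \<open>x = c = l + 1\<close>, where its right-hand side is zero.\<close>

lemma Suc_mult_ln_antimono:
  assumes "n \<ge> 1" "n \<le> l"
  shows "(real l + 1) * ln ((real l + 1) / real l) \<le> (real n + 1) * ln ((real n + 1) / real n)"
  using assms(2)
proof (induction l rule: dec_induct)
  case (step l)
  with assms have l: "real l > 0" by simp
  have "(real l + 1 + 1) * ln ((real l + 1 + 1) / (real l + 1)) \<le> (real l + 1) * ln ((real l + 1) / real l)"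
    using mult_ln_diff_le[of "real l + 1" "real l + 1" "real l"] l by (simp add: ln_div algebra_simps)
  then show ?case using step.IH by (simp add: add_ac)
qed simp

text \<open>With \<open>y = exp t\<close> this is \<open>t < sinh t\<close>. It supplies the sign of
  the derivative in \<open>mult_ln_ratio_decreasing\<close>.\<close>

lemma ln_less_half_diff_inverse:
  fixes y :: real
  assumes "y > 1"
  shows "ln y < (y - 1 / y) / 2"
proof -
  define f where "f = (\<lambda>y::real. ln y - (y - 1 / y) / 2)"
  have "f y < f 1"
  proof (rule DERIV_neg_imp_decreasing_open[OF assms])
    fix x :: real assume x: "1 < x" "x < y"
    have "(f has_real_derivative - ((x - 1)^2 / (2 * x^2))) (at x)"
      unfolding f_def using x
      by (auto intro!: derivative_eq_intros simp: field_simps power2_eq_square)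
    moreover have "- ((x - 1)^2 / (2 * x^2)) < 0" using x by simp
    ultimately show "\<exists>d. (f has_real_derivative d) (at x) \<and> d < 0" by blast
  next
    show "continuous_on {1..y} f" unfolding f_def by (auto intro!: continuous_intros)
  qed
  then show ?thesis by (simp add: f_def)
qed

text \<open>The two sides are \<open>f (x + 1)\<close> and \<open>f x\<close> for
  \<open>f z = z * ln ((z + 1) / (z - 1))\<close>. In terms of \<open>y = (z + 1) / (z - 1)\<close>
  the derivative of \<open>f\<close> is \<open>ln y - (y - 1 / y) / 2\<close>, which is
  negative.\<close>

lemma mult_ln_ratio_decreasing:
  fixes x :: real
  assumes "x > 1"
  shows "(x + 1) * ln ((x + 2) / x) < x * ln ((x + 1) / (x - 1))"
proof -
  define f where "f = (\<lambda>x::real. x * (ln (x + 1) - ln (x - 1)))"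
  have "f (x + 1) < f x"
  proof (rule DERIV_neg_imp_decreasing[of x "x + 1" f])
    fix z assume z: "x \<le> z" "z \<le> x + 1"
    with assms have z1: "z > 1" by simp
    have "(f has_real_derivative (ln (z + 1) - ln (z - 1)) + z * (1 / (z + 1) - 1 / (z - 1))) (at z)"
      unfolding f_def using z1 by (auto intro!: derivative_eq_intros simp: diff_divide_distrib)
    moreover have "ln ((z + 1) / (z - 1)) < ((z + 1) / (z - 1) - 1 / ((z + 1) / (z - 1))) / 2"
      using z1 by (intro ln_less_half_diff_inverse) simp
    moreover have "((z + 1) / (z - 1) - 1 / ((z + 1) / (z - 1))) / 2 = - (z * (1 / (z + 1) - 1 / (z - 1)))"
      using z1 by (simp add: divide_simps) (simp add: algebra_simps power2_eq_square)
    ultimately show "\<exists>d. (f has_real_derivative d) (at z) \<and> d < 0"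
      using z1 by (intro exI[of _ "(ln (z + 1) - ln (z - 1)) + z * (1 / (z + 1) - 1 / (z - 1))"])
        (simp add: ln_div)
  qed simp
  then show ?thesis using assms by (simp add: f_def ln_div add_ac)
qed

text \<open>
  The logarithm of the quotient of the two sides is extremal at \<open>y = n\<close>, \<open>u = m + 1\<close> and \<open>n = m - 1\<close>,
  where the claim is \<open>mult_ln_ratio_decreasing\<close>.
\<close>

lemma power_ratio_step:
  fixes u y :: real and n m :: nat
  assumes "n \<ge> 1" "n < m" "real m \<le> u" "u \<le> real m + 1" "y > 0"
  shows "real n * y ^ n * (u + 1) ^ Suc m < real m * (y + 1) ^ Suc n * u ^ m"
proof -
  have n: "real n > 0" and m: "real m > 1" and u: "u > 0" using assms by auto
  have 1: "real n * ln y - (real n + 1) * ln (y + 1) \<le> real n * ln (real n) - (real n + 1) * ln (real n + 1)"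
    using mult_ln_diff_le[of "real n" "real n" y] n assms by simp
  have "(real m + 1 - u) / (real m + 1 + 1) * (real m / u - 1) \<le> 0"
    using assms u by (intro mult_nonneg_nonpos) (auto simp: field_simps)
  then have 2: "real m * ln (real m + 1) - (real m + 1) * ln (real m + 2) \<le> real m * ln u - (real m + 1) * ln (u + 1)"
    using mult_ln_diff_le[of "real m" u "real m + 1"] m u by (simp add: add_ac)
  have 3: "real m * ln (real m / (real m - 1)) \<le> (real n + 1) * ln ((real n + 1) / real n)"
    using Suc_mult_ln_antimono[of n "m - 1"] assms by (simp add: of_nat_diff)
  have 4: "(real m + 1) * ln ((real m + 2) / real m) < real m * ln ((real m + 1) / (real m - 1))"
    using mult_ln_ratio_decreasing[OF m] .
  have "ln (real n) + real n * ln y + (real m + 1) * ln (u + 1) <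
      ln (real m) + (real n + 1) * ln (y + 1) + real m * ln u"
    using 1 2 3 4 n m by (simp add: ln_div algebra_simps)
  then have "ln (real n * y ^ n * (u + 1) ^ Suc m) < ln (real m * (y + 1) ^ Suc n * u ^ m)"
    using n m u assms by (simp add: ln_mult ln_realpow ring_distribs del: power_Suc)
  then show ?thesis using n m u assms by (subst (asm) ln_less_cancel_iff) auto
qed

section \<open>Binomial terms and their Poisson limit\<close>

text \<open>After cancelling \<open>(M choose k) * w ^ k\<close> this is
  \<open>power_ratio_step\<close> with \<open>m = M + 1\<close>, \<open>n = M + 1 - k\<close> and
  \<open>y = u - w\<close>.\<close>

lemma binomial_step_less:
  fixes w u :: real
  assumes k: "k \<ge> 1" "k \<le> M" and u: "real M + 1 \<le> u" "u \<le> real M + 2" and w: "0 < w" "w < u"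
  shows "real (M choose k) * (w / u) ^ k * (1 - w / u) ^ (Suc M - k)
    < real (Suc M choose k) * (w / (u + 1)) ^ k * (1 - w / (u + 1)) ^ (Suc (Suc M) - k)"
proof -
  define n where "n = Suc M - k"
  define y where "y = u - w"
  have n: "n \<ge> 1" "n < Suc M" and y: "y > 0" and u0: "u > 0"
    using assms by (auto simp: n_def y_def)
  have M: "Suc M = k + n" and M': "Suc (Suc M) - k = Suc n" using k by (auto simp: n_def)
  have step: "real n * y ^ n * (u + 1) ^ Suc (Suc M) < real (Suc M) * (y + 1) ^ Suc n * u ^ Suc M"
    using n u y by (intro power_ratio_step) auto
  have ch: "real (Suc M choose k) = real (Suc M) / real n * real (M choose k)"
  proof -
    have "(Suc M - k) * (Suc M choose k) = Suc M * (M choose k)"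
      using binomial_absorb_comp[of "Suc M" k] by simp
    then have "real n * real (Suc M choose k) = real (Suc M) * real (M choose k)"
      unfolding n_def by (metis of_nat_mult)
    then show ?thesis using n by (simp add: field_simps)
  qed
  have c: "real (M choose k) > 0" using k by simp
  have 1: "1 - w / u = y / u" "1 - w / (u + 1) = (y + 1) / (u + 1)"
    using u0 by (auto simp: y_def field_simps)
  have L: "real (M choose k) * (w / u) ^ k * (y / u) ^ n = real (M choose k) * w ^ k * (y ^ n / u ^ Suc M)"
    unfolding M by (simp add: power_divide power_add)
  have R: "real (Suc M choose k) * (w / (u + 1)) ^ k * ((y + 1) / (u + 1)) ^ Suc n
    = real (M choose k) * w ^ k * (real (Suc M) / real n * ((y + 1) ^ Suc n / (u + 1) ^ Suc (Suc M)))"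
  proof -
    have "Suc (Suc M) = k + Suc n" using M by simp
    then show ?thesis unfolding ch by (simp only: power_divide power_add) (simp add: mult_ac)
  qed
  have "y ^ n / u ^ Suc M < real (Suc M) / real n * ((y + 1) ^ Suc n / (u + 1) ^ Suc (Suc M))"
  proof -
    have "u ^ Suc M > 0" "(u + 1) ^ Suc (Suc M) > 0" "real n > 0" using u0 n by auto
    with step show ?thesis
      by (simp add: divide_simps del: power_Suc of_nat_Suc) (simp add: mult_ac del: power_Suc of_nat_Suc)
  qed
  then show ?thesis unfolding 1 M' n_def[symmetric] L R
    using c w by (intro mult_strict_left_mono) auto
qed

text \<open>The Poisson limit theorem, over an arbitrary filter because it is needed both along a
  sequence and for \<open>p \<rightarrow> 0\<close>. Up to \<open>fact k\<close>, the binomial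
  coefficient and \<open>p ^ k\<close> combine into \<open>k\<close> factors
  \<open>M * p - i * p\<close>, each tending to \<open>w\<close>; \<open>(1 - p) ^ M\<close> is
  \<open>exp (M * p * (ln (1 - p) / p))\<close>.\<close>

lemma tendsto_binomial_poisson:
  fixes p :: "'a \<Rightarrow> real" and M :: "'a \<Rightarrow> nat"
  assumes p0: "filterlim p (at_right 0) F" and Mp: "((\<lambda>x. real (M x) * p x) \<longlongrightarrow> w) F"
    and kM: "eventually (\<lambda>x. k \<le> M x) F"
  shows "((\<lambda>x. real (M x choose k) * p x ^ k * (1 - p x) ^ (Suc (M x) - k))
    \<longlongrightarrow> w ^ k * exp (- w) / fact k) F"
proof -
  have p: "(p \<longlongrightarrow> 0) F" using p0 by (simp add: filterlim_at)
  have "eventually (\<lambda>x::real. x < 1 \<and> x > 0) (at_right 0)"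
    by (auto simp: eventually_at_right_field intro: exI[of _ 1])
  then have p1: "eventually (\<lambda>x. p x < 1 \<and> p x > 0) F"
    using p0 by (rule eventually_compose_filterlim)
  have "((\<lambda>x. (\<Prod>i=0..<k. real (M x) * p x - real i * p x)) \<longlongrightarrow> (\<Prod>i=0..<k. w - real i * 0)) F"
    by (intro tendsto_intros Mp p)
  then have lim1: "((\<lambda>x. (\<Prod>i=0..<k. real (M x) * p x - real i * p x) / fact k) \<longlongrightarrow> w ^ k / fact k) F"
    by (intro tendsto_divide) auto
  have ln_lim: "((\<lambda>x::real. ln (1 - x) / x) \<longlongrightarrow> -1) (at_right 0)"
  proof -
    have "((\<lambda>x::real. ln (1 - x)) has_real_derivative -1) (at 0)"
      by (auto intro!: derivative_eq_intros)
    then have "((\<lambda>x::real. ln (1 - x) / x) \<longlongrightarrow> -1) (at 0)"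
      by (simp add: has_field_derivative_iff)
    then show ?thesis by (rule filterlim_mono[OF _ order_refl at_le]) auto
  qed
  have lim2: "((\<lambda>x. ln (1 - p x) / p x) \<longlongrightarrow> -1) F"
    using filterlim_compose[OF ln_lim p0] .
  have "((\<lambda>x. exp (real (M x) * p x * (ln (1 - p x) / p x)) * ((1 - p x) / (1 - p x) ^ k))
      \<longlongrightarrow> exp (w * -1) * ((1 - 0) / (1 - 0) ^ k)) F"
    by (intro tendsto_intros Mp p lim2) auto
  from tendsto_mult[OF lim1 this]
  have "((\<lambda>x. (\<Prod>i=0..<k. real (M x) * p x - real i * p x) / fact k *
      (exp (real (M x) * p x * (ln (1 - p x) / p x)) * ((1 - p x) / (1 - p x) ^ k)))
      \<longlongrightarrow> w ^ k * exp (- w) / fact k) F" by simp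
  then show ?thesis
  proof (rule Lim_transform_eventually)
    show "\<forall>\<^sub>F x in F. (\<Prod>i=0..<k. real (M x) * p x - real i * p x) / fact k *
      (exp (real (M x) * p x * (ln (1 - p x) / p x)) * ((1 - p x) / (1 - p x) ^ k)) =
      real (M x choose k) * p x ^ k * (1 - p x) ^ (Suc (M x) - k)"
      using p1 kM
    proof eventually_elim
      case (elim x)
      have "exp (real (M x) * p x * (ln (1 - p x) / p x)) = exp (real (M x) * ln (1 - p x))"
        using elim by simp
      also have "\<dots> = (1 - p x) ^ M x"
        using elim by (simp add: exp_of_nat_mult)
      finally have 1: "exp (real (M x) * p x * (ln (1 - p x) / p x)) * ((1 - p x) / (1 - p x) ^ k)
          = (1 - p x) ^ (Suc (M x) - k)"
        using elim by (simp add: power_diff)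
      have "(\<Prod>i=0..<k. real (M x) * p x - real i * p x) = (\<Prod>i=0..<k. (real (M x) - real i)) * p x ^ k"
        by (simp flip: left_diff_distrib add: prod.distrib)
      also have "\<dots> / fact k = real (M x choose k) * p x ^ k"
        by (simp add: binomial_gbinomial gbinomial_prod_rev)
      finally show ?case unfolding 1 by simp
    qed
  qed
qed

lemma binomial_less_poisson:
  fixes p w :: real
  assumes k: "k \<ge> 1" "k \<le> M" and p: "0 < p" "p < 1" and w: "(real M + 1) * p \<le> w" "w \<le> (real M + 2) * p"
  shows "real (M choose k) * p ^ k * (1 - p) ^ (Suc M - k) < w ^ k * exp (- w) / fact k"
proof -
  define u where "u = w / p"
  have w0: "w > 0" using w p by (smt (verit) mult_pos_pos of_nat_0_le_iff)
  have u: "real M + 1 \<le> u" "u \<le> real M + 2" "w < u" and p_eq: "p = w / u"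
    using p w w0 by (auto simp: u_def field_simps)
  \<comment> \<open>\<open>V 0\<close> is the left-hand side of the claim. \<open>M\<close> and
    \<open>u\<close> grow together while \<open>w\<close> stays fixed, so the mean
    \<open>(M + i) * (w / (u + i))\<close> tends to \<open>w\<close>.\<close>
  define V where "V = (\<lambda>i. real (M + i choose k) * (w / (u + real i)) ^ k *
    (1 - w / (u + real i)) ^ (Suc (M + i) - k))"
  have less: "V i < V (Suc i)" for i
    using binomial_step_less[of k "M + i" "u + real i" w] k u w0 by (simp add: V_def add_ac)
  have "V \<longlonglongrightarrow> w ^ k * exp (- w) / fact k"
    unfolding V_def
  proof (rule tendsto_binomial_poisson)
    show "filterlim (\<lambda>i. w / (u + real i)) (at_right 0) sequentially"
      using w0 by real_asymp
    show "(\<lambda>i. real (M + i) * (w / (u + real i))) \<longlonglongrightarrow> w"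
      using w0 by real_asymp
    show "eventually (\<lambda>i. k \<le> M + i) sequentially" using k by simp
  qed
  moreover have "incseq V" using less by (intro incseq_SucI) (simp add: less_imp_le)
  \<comment> \<open>Bounding \<open>V 1\<close> instead of \<open>V 0\<close> by the limit keeps the
    final inequality strict.\<close>
  ultimately have "V 1 \<le> w ^ k * exp (- w) / fact k" by (intro incseq_le)
  with less[of 0] show ?thesis by (simp add: V_def p_eq)
qed

section \<open>Telescoping and the risk as a finite sum\<close>

text \<open>Each summand is the increment of the right-hand side in \<open>M\<close>; the condition
  \<open>eq\<close> is exactly what makes this so. The index \<open>j\<close> stands for
  \<open>n - 1\<close>: the \<open>b\<close> part contains the enlarged \<open>w / (j * p)\<close>,
  the \<open>a\<close> part the true \<open>n = j + 1\<close>.\<close>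

lemma sum_neg_binomial_bracket:
  fixes p w A B :: real
  assumes k: "k \<ge> 1" "k \<le> M" and p: "0 < p" "p < 1" and w: "w > 0"
    and eq: "b * (w / real k - 1) + a * (1 - (real k + 1) / w) = 0"
  shows "(\<Sum>j=k..M. real (j choose k) * p ^ Suc k * (1 - p) ^ (j - k) *
      (b * (w / (real j * p) - 1) - a * ((real j + 1) * p / w - 1)))
    = real (M choose k) * p ^ k * (1 - p) ^ (Suc M - k) * (b * w / real k + a * (real M + 1) * p / w)"
  using k(2)
proof (induction M rule: dec_induct)
  case base
  define z where "z = real k"
  have z: "z > 0" using k by (simp add: z_def)
  \<comment> \<open>The surplus on the right is \<open>p\<close> times the left side of
    \<open>eq\<close>, hence zero; the induction step has the same surplus.\<close>
  have "p * (b * (w / (z * p) - 1) - a * ((z + 1) * p / w - 1)) =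
      (1 - p) * (b * w / z + a * (z + 1) * p / w) + p * (b * (w / z - 1) + a * (1 - (z + 1) / w))"
    using z p w by (simp add: field_simps)
  then show ?case using eq by (simp add: z_def mult.commute mult.left_commute)
next
  case (step M)
  define z where "z = real k"
  define n where "n = Suc M - k"
  define C where "C = real (Suc M choose k)"
  define x where "x = real M + 1"
  have z: "z > 0" using k by (simp add: z_def)
  have x: "x > 0" by (simp add: x_def)
  have n: "Suc (Suc M) - k = Suc n" "real n = x - z" using step by (auto simp: n_def x_def z_def)
  have ch: "real (M choose k) = real n / x * C"
  proof -
    have "(Suc M - k) * (Suc M choose k) = Suc M * (M choose k)"
      using binomial_absorb_comp[of "Suc M" k] by simp
    then have "real n * C = x * real (M choose k)"
      unfolding n_def C_def x_def by (metis of_nat_mult of_nat_Suc add.commute)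
    then show ?thesis using x by (simp add: field_simps)
  qed
  have "(x - z) / x * (b * w / z + a * x * p / w) + p * (b * (w / (x * p) - 1) - a * ((x + 1) * p / w - 1))
    = (1 - p) * (b * w / z + a * (x + 1) * p / w) + p * (b * (w / z - 1) + a * (1 - (z + 1) / w))"
    using x z w p by (simp add: field_simps)
  then have "C * p ^ k * (1 - p) ^ n * ((x - z) / x * (b * w / z + a * x * p / w) +
        p * (b * (w / (x * p) - 1) - a * ((x + 1) * p / w - 1)))
    = C * p ^ k * (1 - p) ^ n * ((1 - p) * (b * w / z + a * (x + 1) * p / w))"
    using eq by (simp add: z_def)
  moreover have xM: "real (Suc M) = x" by (simp add: x_def)
  have "(\<Sum>j=k..Suc M. real (j choose k) * p ^ Suc k * (1 - p) ^ (j - k) *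
      (b * (w / (real j * p) - 1) - a * ((real j + 1) * p / w - 1)))
    = real (M choose k) * p ^ k * (1 - p) ^ n * (b * w / z + a * x * p / w) +
      C * p ^ Suc k * (1 - p) ^ n * (b * (w / (x * p) - 1) - a * ((x + 1) * p / w - 1))"
    using step.hyps step.IH by (simp add: sum.cl_ivl_Suc n_def C_def z_def x_def add_ac del: binomial_Suc_Suc)
  \<comment> \<open>Rearrangement with the powers and binomial coefficients kept opaque as
    variables.\<close>
  moreover have "(R * C) * P * Q * X + C * (p * P) * Q * Y = C * P * ((1 - p) * Q) * Z"
    if "C * P * Q * (R * X + p * Y) = C * P * Q * ((1 - p) * Z)" for P Q R X Y Z
    using that by (simp add: algebra_simps)
  ultimately show ?case
    unfolding n(1) ch n(2) xM C_def[symmetric] z_def[symmetric] by (simp only: power_Suc)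
qed

text \<open>Using the branch \<open>a * (1 / x - 1)\<close> for every \<open>n\<close> gives an
  affine function of \<open>N\<close>, whose mean follows from that of \<open>N\<close>. A
  correction is needed only for \<open>n \<le> M + 1\<close>, where \<open>M + 1\<close> is the
  floor of \<open>w / p\<close>; shifting to \<open>j = n - 1\<close> gives the sum.\<close>

lemma risk_inv_lin_loss_eq:
  fixes a b w p :: real
  assumes p: "0 < p" "p < 1" and w: "w > 0" and M: "(real M + 1) * p \<le> w" "w < (real M + 2) * p"
  shows "risk (inv_lin_loss a b) (\<lambda>n. w / real n) (Suc k) p = a * (real (Suc k) / w - 1) +
    (\<Sum>j=k..M. real (j choose k) * p ^ Suc k * (1 - p) ^ (j - k) *
      (b * (w / ((real j + 1) * p) - 1) - a * ((real j + 1) * p / w - 1)))"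
proof -
  define q where "q = map_pmf (\<lambda>k'. k' + Suc k) (neg_binomial_pmf (Suc k) p)"
  define h where "h = (\<lambda>n. if n \<le> Suc M then b * (w / (real n * p) - 1) - a * (real n * p / w - 1) else 0)"
  have pmf_q: "pmf q n = (if Suc k \<le> n then real ((n - 1) choose k) * p ^ Suc k * (1 - p) ^ (n - Suc k) else 0)" for n
    unfolding q_def using pmf_shifted_neg_binomial[OF p, of "Suc k" n] by (simp del: power_Suc)
  have supp: "n \<ge> Suc k" if "n \<in> set_pmf q" for n
    using that by (auto simp: q_def)
  have loss: "inv_lin_loss a b (w / real n / p) = a * (real n * p / w - 1) + h n" if "n > 0" for n
  proof (cases "n \<le> Suc M")
    case True
    then have "real n * p \<le> (real M + 1) * p" using p by (intro mult_right_mono) auto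
    then have le: "real n * p \<le> w" using M by simp
    \<comment> \<open>At \<open>n * p = w\<close> the loss is in its first branch, but there the
      correction \<open>h n\<close> vanishes as well.\<close>
    show ?thesis
    proof (cases "real n * p = w")
      case True
      then show ?thesis using w by (simp add: inv_lin_loss_def h_def mult.commute)
    next
      case False
      then have "w / real n / p > 1" using le p that by (simp add: field_simps)
      then show ?thesis using True by (simp add: inv_lin_loss_def h_def)
    qed
  next
    case False
    then have "(real M + 2) * p \<le> real n * p" using p by (intro mult_right_mono) auto
    then have "w / real n / p \<le> 1" using M p that by (simp add: field_simps)
    then show ?thesis using False by (simp add: inv_lin_loss_def h_def mult.commute)
  qed
  have int_real: "integrable (measure_pmf q) real"
  proof -
    have "integrable (measure_pmf (neg_binomial_pmf (Suc k) p)) (\<lambda>x. real x + real (Suc k))"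
      using p by (intro Bochner_Integration.integrable_add integrable_neg_binomial_pmf_real) auto
    then show ?thesis unfolding q_def by (simp add: add_ac)
  qed
  have E_real: "measure_pmf.expectation q real = real (Suc k) / p"
    unfolding q_def using p
    by (simp add: expectation_neg_binomial_pmf integrable_neg_binomial_pmf_real) (simp add: field_simps)
  have supp_h: "n \<in> {Suc k..Suc M}" if "n \<in> set_pmf q" "h n \<noteq> 0" for n
    using supp[OF that(1)] that(2) by (auto simp: h_def split: if_splits)
  have int_h: "integrable (measure_pmf q) h"
  proof (rule measure_pmf.integrable_const_bound)
    have "norm (h n) \<le> (\<Sum>i\<le>Suc M. \<bar>h i\<bar>)" for n
    proof (cases "n \<le> Suc M")
      case True
      then have "\<bar>h n\<bar> \<le> (\<Sum>i\<le>Suc M. \<bar>h i\<bar>)" by (intro member_le_sum) auto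
      then show ?thesis by simp
    qed (simp add: h_def sum_nonneg)
    then show "AE n in measure_pmf q. norm (h n) \<le> (\<Sum>i\<le>Suc M. \<bar>h i\<bar>)" by simp
  qed simp
  have "risk (inv_lin_loss a b) (\<lambda>n. w / real n) (Suc k) p =
      measure_pmf.expectation q (\<lambda>n. inv_lin_loss a b (w / real n / p))"
    unfolding q_def using p by (intro risk_eq_expectation) auto
  also have "\<dots> = measure_pmf.expectation q (\<lambda>n. a * (real n * p / w - 1) + h n)"
  proof (rule integral_cong_AE)
    show "AE n in measure_pmf q. inv_lin_loss a b (w / real n / p) = a * (real n * p / w - 1) + h n"
      using loss[OF less_le_trans[OF zero_less_Suc supp]] by (simp add: AE_measure_pmf_iff)
  qed simp_all
  also have "\<dots> = a * (measure_pmf.expectation q real * p / w - 1) + measure_pmf.expectation q h"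
    using int_real int_h by simp
  also have "measure_pmf.expectation q h = (\<Sum>n=Suc k..Suc M. h n * pmf q n)"
    using supp_h by (intro integral_measure_pmf_real) auto
  also have "\<dots> = (\<Sum>j=k..M. h (Suc j) * pmf q (Suc j))"
    by (rule sum.shift_bounds_cl_Suc_ivl)
  also have "\<dots> = (\<Sum>j=k..M. real (j choose k) * p ^ Suc k * (1 - p) ^ (j - k) *
      (b * (w / ((real j + 1) * p) - 1) - a * ((real j + 1) * p / w - 1)))"
    by (intro sum.cong) (auto simp: h_def pmf_q add_ac)
  finally show ?thesis using p unfolding E_real by simp
qed

section \<open>The constant \<Omega>\<close>

lemma Omega_opt_ge:
  assumes "a \<ge> 0" "b \<ge> 0"
  shows "real k \<le> Omega_opt a b (Suc k)"
proof -
  have "1 \<le> sqrt (1 + 4 * a * b / (real k * (a + b)\<^sup>2))"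
    using assms by simp
  then have "real k * 1 \<le> real k * (1 + (a + b) / (2 * b) * (sqrt (1 + 4 * a * b / (real k * (a + b)\<^sup>2)) - 1))"
    using assms by (intro mult_left_mono) auto
  then show ?thesis by (auto simp: Omega_opt_def)
qed

text \<open>For \<open>a, b > 0\<close> and \<open>t = w / k\<close>, multiplying by
  \<open>t\<close> gives the quadratic equation
  \<open>b * t^2 - (b - a) * t = a * (1 + 1 / k)\<close>. Its discriminant is
  \<open>(a + b)^2 + 4 * a * b / k\<close>, the source of the square root in
  \<open>Omega_opt\<close>.\<close>

lemma Omega_opt_balance:
  assumes ab: "a \<ge> 0" "b \<ge> 0" and k: "k \<ge> 1"
  defines "w \<equiv> Omega_opt a b (Suc k)"
  shows "b * (w / real k - 1) + a * (1 - (real k + 1) / w) = 0"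
proof -
  have z: "real k > 0" using k by simp
  consider "a = 0" | "a > 0" "b = 0" | "a > 0" "b > 0" using ab by linarith
  then show ?thesis
  proof cases
    case 3
    define s where "s = sqrt (1 + 4 * a * b / (real k * (a + b)\<^sup>2))"
    define t where "t = w / real k"
    have w0: "w > 0" using Omega_opt_ge[OF ab, of k] z by (simp add: w_def)
    have s2: "(a + b)\<^sup>2 * s\<^sup>2 = (a + b)\<^sup>2 + 4 * a * b / real k"
      unfolding s_def using 3 z by (simp add: real_sqrt_pow2 field_simps)
    have "t = 1 + (a + b) / (2 * b) * (s - 1)"
      using 3 z by (simp add: t_def w_def Omega_opt_def s_def)
    then have "2 * b * t - (b - a) = (a + b) * s"
      using 3 by (simp add: field_simps)
    then have "(2 * b * t - (b - a))\<^sup>2 = (a + b)\<^sup>2 + 4 * a * b / real k"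
      using s2 by (simp add: power_mult_distrib)
    then have "4 * b * (b * t\<^sup>2 - (b - a) * t) = 4 * b * (a + a / real k)"
      by (simp add: power2_eq_square algebra_simps)
    then have "b * t\<^sup>2 - (b - a) * t = a + a / real k" using 3 by simp
    then have "(b * (t - 1) + a) * t = a * (1 + 1 / real k)" by (simp add: power2_eq_square algebra_simps)
    moreover have t: "t > 0" and "(real k + 1) / w = (1 + 1 / real k) / t"
      using w0 z by (simp_all add: t_def field_simps)
    ultimately have "(b * (t - 1) + a) * t = (a * ((real k + 1) / w)) * t" by simp
    then have "b * (t - 1) + a = a * ((real k + 1) / w)" using t by (metis mult_right_cancel less_irrefl)
    then show ?thesis unfolding t_def[symmetric] by (simp add: right_diff_distrib)
  qed (use z in \<open>auto simp: w_def Omega_opt_def\<close>)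
qed

section \<open>The error of the replacement\<close>

text \<open>The weights are point masses of the number of trials up to the \<open>k\<close>-th
  success, so they sum to at most 1. For \<open>j \<le> J\<close> a weight is at most
  \<open>p\<close> times its binomial coefficient; for larger \<open>j\<close> the denominator
  exceeds \<open>J + 1\<close>.\<close>

lemma sum_neg_binomial_inverse_le:
  fixes p :: real
  assumes k: "k \<ge> 1" and p: "0 < p" "p < 1"
  shows "(\<Sum>j=k..M. real ((j - 1) choose (k - 1)) * p ^ k * (1 - p) ^ (j - k) / (real j + 1))
    \<le> p * (\<Sum>j=k..J. real ((j - 1) choose (k - 1))) + 1 / (real J + 1)"
proof -
  define c where "c = (\<lambda>j. real ((j - 1) choose (k - 1)))"
  define g where "g = (\<lambda>j. c j * p ^ k * (1 - p) ^ (j - k))"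
  have g0: "g j \<ge> 0" for j using p by (simp add: g_def c_def)
  have "sum g {k..M} = (\<Sum>j=k..M. pmf (map_pmf (\<lambda>i. i + k) (neg_binomial_pmf k p)) j)"
    using pmf_shifted_neg_binomial[OF p k] by (intro sum.cong) (auto simp: g_def c_def)
  also have "\<dots> \<le> 1"
    by (subst measure_measure_pmf_finite[symmetric]) auto
  finally have g1: "sum g {k..M} \<le> 1" .
  have "g j / (real j + 1) \<le> (if j \<in> {..J} then p * c j else 0) + g j / (real J + 1)" for j
  proof (cases "j \<le> J")
    case True
    have "p ^ k * (1 - p) ^ (j - k) \<le> p * 1"
      using p k power_decreasing[of 1 k p] by (intro mult_mono power_le_one) auto
    then have "c j * (p ^ k * (1 - p) ^ (j - k)) \<le> c j * (p * 1)"
      by (intro mult_left_mono) (auto simp: c_def)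
    then have "g j \<le> p * c j" by (simp add: g_def mult_ac)
    moreover have "g j / (real j + 1) \<le> g j" using g0[of j] by (simp add: field_simps)
    moreover have "g j / (real J + 1) \<ge> 0" using g0[of j] by simp
    ultimately show ?thesis using True by simp
  next
    case False
    then show ?thesis using g0[of j] by (auto intro!: divide_left_mono)
  qed
  then have "(\<Sum>j=k..M. g j / (real j + 1)) \<le>
      (\<Sum>j=k..M. (if j \<in> {..J} then p * c j else 0) + g j / (real J + 1))"
    by (intro sum_mono)
  also have "\<dots> = (\<Sum>j\<in>{k..M} \<inter> {..J}. p * c j) + sum g {k..M} / (real J + 1)"
    by (simp only: sum.distrib sum.inter_restrict[OF finite_atLeastAtMost] sum_divide_distrib)
  also have "\<dots> \<le> (\<Sum>j=k..J. p * c j) + 1 / (real J + 1)"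
    using p g1 by (intro add_mono sum_mono2 divide_right_mono) (auto simp: c_def)
  finally show ?thesis by (simp add: g_def c_def sum_distrib_left)
qed

text \<open>First \<open>J\<close> is chosen to make the tail small, independently of
  \<open>p\<close> and \<open>M p\<close>; then \<open>p\<close> is taken small for this fixed
  \<open>J\<close>.\<close>

lemma tendsto_sum_neg_binomial_inverse:
  fixes M :: "real \<Rightarrow> nat"
  assumes k: "k \<ge> 1"
  shows "((\<lambda>p. \<Sum>j=k..M p. real ((j - 1) choose (k - 1)) * p ^ k * (1 - p) ^ (j - k) / (real j + 1))
    \<longlongrightarrow> 0) (at_right 0)" (is "(?E \<longlongrightarrow> 0) _")
proof (rule tendstoI)
  fix e :: real assume e: "e > 0"
  then obtain J where J: "1 / (real J + 1) < e / 2"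
    using reals_Archimedean[of "e / 2"] by (auto simp: inverse_eq_divide add_ac)
  define c where "c = (\<Sum>j=k..J. real ((j - 1) choose (k - 1)))"
  have "((\<lambda>p. p * c) \<longlongrightarrow> 0 * c) (at_right 0)" by (intro tendsto_intros)
  then have "\<forall>\<^sub>F p in at_right 0. p * c < e / 2"
    using e by (intro order_tendstoD(2)) auto
  moreover have "\<forall>\<^sub>F p in at_right (0::real). 0 < p \<and> p < 1"
    by (auto simp: eventually_at_right_field intro: exI[of _ 1])
  ultimately show "\<forall>\<^sub>F p in at_right 0. dist (?E p) 0 < e"
  proof eventually_elim
    case (elim p)
    have "?E p \<ge> 0" using elim by (intro sum_nonneg) auto
    moreover have "?E p \<le> p * c + 1 / (real J + 1)"
      unfolding c_def using elim k by (intro sum_neg_binomial_inverse_le) auto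
    ultimately show ?case using elim J by simp
  qed
qed

section \<open>Bound and limit of the risk\<close>

theorem theorem2:
  fixes a b :: real and r :: nat
  assumes "a \<ge> 0" and "b \<ge> 0" and "(a, b) \<noteq> (0, 0)" and "r \<ge> 2"
  defines "\<Omega> \<equiv> Omega_opt a b r"
  defines "\<eta> \<equiv> risk (inv_lin_loss a b) (\<lambda>n. \<Omega> / real n) r"
  defines "c \<equiv> a * (real r / \<Omega> - 1)
                 + (a * real r / \<Omega> + b) * (\<Omega> ^ (r - 1) * exp (- \<Omega>) / fact (r - 1))"
  shows "(\<eta> \<longlongrightarrow> c) (at_right 0) \<and> (\<forall>p\<in>{0<..<1}. \<eta> p < c)"
proof -
  define k where "k = r - 1"
  have r: "r = Suc k" and k: "k \<ge> 1" using assms(4) by (auto simp: k_def)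
  have k0: "real k \<ge> 1" using k by simp
  have w: "\<Omega> \<ge> 1" "\<Omega> > 0" using Omega_opt_ge[OF assms(1,2), of k] k0 by (auto simp: \<Omega>_def r)
  have balance: "b * (\<Omega> / real k - 1) + a * (1 - (real k + 1) / \<Omega>) = 0"
    unfolding \<Omega>_def r using assms(1,2) k by (rule Omega_opt_balance)
  define K where "K = b * \<Omega> / real k + a"
  define L where "L = \<Omega> ^ k * exp (- \<Omega>) / fact k"
  define A where "A = a * (real r / \<Omega> - 1)"
  have K: "K > 0"
  proof (cases "a = 0")
    case True
    then show ?thesis using assms(2,3) w k0 by (simp add: K_def)
  next
    case False
    then show ?thesis using assms(1,2) w k0 by (intro add_nonneg_pos[of "b * \<Omega> / real k" a, folded K_def]) auto
  qed
  have L: "L > 0" using w by (simp add: L_def)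
  have c_eq: "c = A + K * L"
  proof -
    have "a * real r / \<Omega> + b = K"
      using balance by (simp add: K_def r algebra_simps)
    then show ?thesis by (simp add: c_def A_def L_def r)
  qed
  \<comment> \<open>The truncated subtraction is harmless: \<open>\<Omega> / p \<ge> 1\<close>, so
    \<open>M p + 1\<close> is the floor of \<open>\<Omega> / p\<close>.\<close>
  define M where "M = (\<lambda>p. nat \<lfloor>\<Omega> / p\<rfloor> - 1)"
  have M: "(real (M p) + 1) * p \<le> \<Omega>" "\<Omega> < (real (M p) + 2) * p" if p: "0 < p" "p < 1" for p
  proof -
    have "\<Omega> / p \<ge> 1" using p w by simp
    then have "\<lfloor>\<Omega> / p\<rfloor> \<ge> 1" by simp
    then have "int (M p) + 1 = \<lfloor>\<Omega> / p\<rfloor>" unfolding M_def by linarith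
    then have "real (M p) + 1 = of_int \<lfloor>\<Omega> / p\<rfloor>"
      by (metis of_int_add of_int_of_nat_eq of_int_1)
    then have "real (M p) + 1 \<le> \<Omega> / p" "\<Omega> / p < real (M p) + 2" by linarith+
    then show "(real (M p) + 1) * p \<le> \<Omega>" "\<Omega> < (real (M p) + 2) * p"
      using p by (simp_all add: field_simps)
  qed
  \<comment> \<open>\<open>T\<close> is the telescoped sum; \<open>E\<close> is the expectation of
    \<open>1 / (N' + 1)\<close> on \<open>N' \<le> M p\<close>, with \<open>N'\<close> the number of
    trials up to the \<open>k\<close>-th success.\<close>
  define T where "T = (\<lambda>p. real (M p choose k) * p ^ k * (1 - p) ^ (Suc (M p) - k) *
      (b * \<Omega> / real k + a * (real (M p) + 1) * p / \<Omega>))"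
  define E where "E = (\<lambda>p. \<Sum>j=k..M p. real ((j - 1) choose (k - 1)) * p ^ k * (1 - p) ^ (j - k) / (real j + 1))"
  \<comment> \<open>Here the sum is empty, since every \<open>n \<ge> r\<close> already exceeds
    \<open>M p + 1\<close>.\<close>
  have \<eta>_small: "\<eta> p = A" if "0 < p" "p < 1" "M p < k" for p
    using risk_inv_lin_loss_eq[OF that(1,2) w(2) M[OF that(1,2)], of a b k] that
    by (simp add: \<eta>_def r A_def)
  have \<eta>_eq: "\<eta> p = A + T p - b * \<Omega> / real k * E p" if p: "0 < p" "p < 1" and kM: "k \<le> M p" for p
  proof -
    \<comment> \<open>Enlarged minus true summand. The brackets differ by
      \<open>b * \<Omega> / (j * (j + 1) * p)\<close>, and absorbing the factor \<open>j\<close>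
      into the binomial coefficient turns the weights of \<open>N\<close> into those of
      \<open>N'\<close>.\<close>
    have "real (j choose k) * p ^ Suc k * (1 - p) ^ (j - k) *
        (b * (\<Omega> / (real j * p) - 1) - a * ((real j + 1) * p / \<Omega> - 1))
      - real (j choose k) * p ^ Suc k * (1 - p) ^ (j - k) *
        (b * (\<Omega> / ((real j + 1) * p) - 1) - a * ((real j + 1) * p / \<Omega> - 1))
      = b * \<Omega> / real k * (real ((j - 1) choose (k - 1)) * p ^ k * (1 - p) ^ (j - k) / (real j + 1))"
      if "j \<in> {k..M p}" for j
    proof -
      have j: "real j > 0" using that k by auto
      have "k * (j choose k) = j * ((j - 1) choose (k - 1))"
        using times_binomial_minus1_eq[of k j] k by simp
      then have "real k * real (j choose k) = real j * real ((j - 1) choose (k - 1))"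
        by (metis of_nat_mult)
      then have ch: "real (j choose k) = real j / real k * real ((j - 1) choose (k - 1))"
        using k0 by (simp add: field_simps)
      have "b * (\<Omega> / (real j * p) - 1) - b * (\<Omega> / ((real j + 1) * p) - 1) = b * \<Omega> / (real j * (real j + 1) * p)"
      proof -
        have "b * (\<Omega> / (x * p) - 1) - b * (\<Omega> / ((x + 1) * p) - 1) = b * \<Omega> / (x * (x + 1) * p)"
          if "x > 0" for x :: real
          using that p by (simp add: divide_simps) (simp add: algebra_simps)
        then show ?thesis using j by blast
      qed
      then have "p * ((b * (\<Omega> / (real j * p) - 1) - X) - (b * (\<Omega> / ((real j + 1) * p) - 1) - X))
        = b * \<Omega> / (real j * (real j + 1))" for X
        using p by simp
      moreover have "C * p ^ Suc k * Q * Y - C * p ^ Suc k * Q * Z = C * p ^ k * Q * (p * (Y - Z))" for C Q Y Z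
        by (simp add: algebra_simps)
      ultimately show ?thesis using j k0 unfolding ch by (simp only:) simp
    qed
    then have "b * \<Omega> / real k * E p = T p - (\<Sum>j=k..M p. real (j choose k) * p ^ Suc k * (1 - p) ^ (j - k) *
      (b * (\<Omega> / ((real j + 1) * p) - 1) - a * ((real j + 1) * p / \<Omega> - 1)))"
      unfolding E_def T_def sum_distrib_left sum_neg_binomial_bracket[OF k kM p w(2) balance, symmetric]
        sum_subtractf[symmetric] by (intro sum.cong) simp_all
    moreover have "\<eta> p = A + (\<Sum>j=k..M p. real (j choose k) * p ^ Suc k * (1 - p) ^ (j - k) *
      (b * (\<Omega> / ((real j + 1) * p) - 1) - a * ((real j + 1) * p / \<Omega> - 1)))"
      unfolding \<eta>_def A_def r using risk_inv_lin_loss_eq[OF p w(2) M[OF p]] .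
    ultimately show ?thesis by simp
  qed
  have "\<eta> p < c" if p: "0 < p" "p < 1" for p
  proof (cases "k \<le> M p")
    case True
    have "E p \<ge> 0" unfolding E_def using p by (intro sum_nonneg) auto
    then have "b * \<Omega> / real k * E p \<ge> 0" using w assms by simp
    moreover have "T p \<le> real (M p choose k) * p ^ k * (1 - p) ^ (Suc (M p) - k) * K"
    proof -
      have "a * ((real (M p) + 1) * p / \<Omega>) \<le> a * 1"
        using M[OF p] w assms by (intro mult_left_mono) auto
      then show ?thesis unfolding T_def K_def using p by (intro mult_left_mono) (auto simp: mult.assoc)
    qed
    moreover have "\<dots> < L * K"
      unfolding L_def using k True p M[OF p] K by (intro mult_strict_right_mono binomial_less_poisson) auto
    ultimately show ?thesis using \<eta>_eq[OF p True] c_eq by (simp add: mult.commute)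
  next
    case False
    then show ?thesis using \<eta>_small[OF p] c_eq K L by simp
  qed
  moreover have "(\<eta> \<longlongrightarrow> c) (at_right 0)"
  proof -
    have ev01: "\<forall>\<^sub>F p in at_right (0::real). 0 < p \<and> p < 1"
      by (auto simp: eventually_at_right_field intro: exI[of _ 1])
    have lim_id: "((\<lambda>p::real. p) \<longlongrightarrow> 0) (at_right 0)" by (intro tendsto_intros)
    have lim_M1: "((\<lambda>p. (real (M p) + 1) * p) \<longlongrightarrow> \<Omega>) (at_right 0)"
    proof (rule tendsto_sandwich)
      \<comment> \<open>Rounding down loses less than one step of length \<open>p\<close>.\<close>
      show "\<forall>\<^sub>F p in at_right 0. \<Omega> - p \<le> (real (M p) + 1) * p"
        using ev01 by eventually_elim (use M in \<open>force simp: algebra_simps\<close>)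
      show "\<forall>\<^sub>F p in at_right 0. (real (M p) + 1) * p \<le> \<Omega>"
        using ev01 by eventually_elim (use M in auto)
      show "((\<lambda>p. \<Omega> - p) \<longlongrightarrow> \<Omega>) (at_right 0)"
        using tendsto_diff[OF tendsto_const lim_id, of \<Omega>] by simp
    qed simp
    have lim_M: "((\<lambda>p. real (M p) * p) \<longlongrightarrow> \<Omega>) (at_right 0)"
      using tendsto_diff[OF lim_M1 lim_id] by (simp add: algebra_simps)
    have "((\<lambda>p. (real k + 2) * p) \<longlongrightarrow> (real k + 2) * 0) (at_right 0)" by (intro tendsto_intros)
    then have "\<forall>\<^sub>F p in at_right 0. (real k + 2) * p < \<Omega>"
      using w by (intro order_tendstoD(2)) auto
    with ev01 have kM: "\<forall>\<^sub>F p in at_right 0. k \<le> M p"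
    proof eventually_elim
      case (elim p)
      with M[of p] have "(real k + 2) * p < (real (M p) + 2) * p" by linarith
      then show ?case using elim by simp
    qed
    have "((\<lambda>p. real (M p choose k) * p ^ k * (1 - p) ^ (Suc (M p) - k)) \<longlongrightarrow> L) (at_right 0)"
      unfolding L_def by (intro tendsto_binomial_poisson lim_M kM) (simp add: filterlim_ident)
    moreover have "((\<lambda>p. b * \<Omega> / real k + a * ((real (M p) + 1) * p) / \<Omega>)
      \<longlongrightarrow> b * \<Omega> / real k + a * \<Omega> / \<Omega>) (at_right 0)"
      using w by (intro tendsto_intros lim_M1) auto
    ultimately have "(T \<longlongrightarrow> L * (b * \<Omega> / real k + a * \<Omega> / \<Omega>)) (at_right 0)"
      unfolding T_def mult.assoc[of a] by (rule tendsto_mult)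
    then have T: "(T \<longlongrightarrow> L * K) (at_right 0)" using w by (simp add: K_def)
    have "(E \<longlongrightarrow> 0) (at_right 0)"
      unfolding E_def using k by (rule tendsto_sum_neg_binomial_inverse)
    with T have "((\<lambda>p. A + T p - b * \<Omega> / real k * E p)
      \<longlongrightarrow> A + L * K - b * \<Omega> / real k * 0) (at_right 0)"
      by (intro tendsto_intros)
    then have "((\<lambda>p. A + T p - b * \<Omega> / real k * E p) \<longlongrightarrow> c) (at_right 0)"
      by (simp add: c_eq mult.commute)
    then show ?thesis
      by (rule Lim_transform_eventually) (use ev01 kM in \<open>eventually_elim, use \<eta>_eq in simp\<close>)
  qed
  ultimately show ?thesis by simp
qed

end
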